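(* Assume $\mathrm{ZFC}$. Let $f:\subseteq\mathbb{N}^\mathbb{N}\rightrightarrows\mathbb{N}$ be such that for each $n\in\mathbb{N}$ the set $f^{-1}(n)=\{x\in\operatorname{dom} f\mid n\in f(x)\}$ is Borel in $\mathbb{N}^\mathbb{N}$. Then exactly one of the following holds: (1) $f\leq_{\mathrm{W}}^*\mathrm{C}_\mathbb{N}$; (2) $\Pi^0_2\mathrm{ACC}_\mathbb{N}\leq_{\mathrm{W}}^* f$.
   Context: $\mathrm{C}_\mathbb{N}$: given an enumeration of the complement of a nonempty set $A\subseteq\mathbb{N}$, output an element of $A$. $\Pi^0_2\mathrm{ACC}_\mathbb{N}$ receives a $\Pi^0_2$ subset $A\subseteq\mathbb{N}$ with $|\mathbb{N}\setminus A|\le1$ and returns some $i\in A$; equivalently: given $p\in\mathbb{N}^\mathbb{N}$, output some $k\in\mathbb{N}$ with $\lim_{n\to\infty}p(n)\neq k$, where the inequality is considered satisfied if the limit does not exist. $g\leq_{\mathrm{W}}^*h$: there are continuous $H,K$ such that for every realizer $G$ of $h$, $p\mapsto K(p,G(H(p)))$ realizes $g$. *)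

theory Defs
  imports "HOL-Analysis.Analysis"
begin

text \<open>The type \<open>nat \<Rightarrow> nat\<close> carries the product topology of the discrete topology on \<open>nat\<close>.\<close>

type_synonym baire = "nat \<Rightarrow> nat"


section \<open>Problems and continuous Weihrauch reducibility\<close>

text \<open>A partial multivalued function is a set-valued function whose domain consists of the
  points with a nonempty set of values. A problem is such a function between two represented
  spaces; representations are partial maps from Baire space.\<close>

definition mdom :: "('x \<Rightarrow> 'y set) \<Rightarrow> 'x set" where
  "mdom f = {x. f x \<noteq> {}}"

record ('x, 'y) problem =
  in_rep :: "baire \<rightharpoonup> 'x"
  out_rep :: "baire \<rightharpoonup> 'y"
  sol :: "'x \<Rightarrow> 'y set"

text \<open>Realizers are partial: nothing may be assumed about them, not even that they are
  defined, outside the names of the instances.\<close>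

definition realizes :: "(baire \<rightharpoonup> baire) \<Rightarrow> ('x, 'y) problem \<Rightarrow> bool" where
  "realizes F P \<longleftrightarrow>
     (\<forall>p x. in_rep P p = Some x \<longrightarrow> x \<in> mdom (sol P) \<longrightarrow>
        (\<exists>q y. F p = Some q \<and> out_rep P q = Some y \<and> y \<in> sol P x))"

definition partial_continuous ::
  "('a::topological_space \<rightharpoonup> 'b::topological_space) \<Rightarrow> bool" where
  "partial_continuous F \<longleftrightarrow> continuous_on (dom F) (\<lambda>x. the (F x))"

text \<open>The partial function \<open>p \<mapsto> K (p, G (H p))\<close>.\<close>

definition reduction_composite ::
  "(baire \<rightharpoonup> baire) \<Rightarrow> (baire \<times> baire \<rightharpoonup> baire) \<Rightarrow> (baire \<rightharpoonup> baire) \<Rightarrow> (baire \<rightharpoonup> baire)" where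
  "reduction_composite H K G =
     (\<lambda>p. Option.bind (H p) (\<lambda>h. Option.bind (G h) (\<lambda>q. K (p, q))))"

definition weihrauch_le :: "('x, 'y) problem \<Rightarrow> ('u, 'v) problem \<Rightarrow> bool"
    (infix "\<le>\<^sub>W\<^sup>*" 50) where
  "P \<le>\<^sub>W\<^sup>* Q \<longleftrightarrow>
     (\<exists>H K. partial_continuous H \<and> partial_continuous K \<and>
        (\<forall>G. realizes G Q \<longrightarrow> realizes (reduction_composite H K G) P))"


section \<open>The problems\<close>

definition rep_nat :: "baire \<rightharpoonup> nat" where
  "rep_nat p = Some (p 0)"

text \<open>The value \<open>0\<close> enumerates nothing, so that the empty set has an enumeration as well.\<close>

definition enumerated :: "baire \<Rightarrow> nat set" where
  "enumerated p = {n. \<exists>k. p k = Suc n}"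

definition rep_closed :: "baire \<rightharpoonup> nat set" where
  "rep_closed p = Some (- enumerated p)"

text \<open>A name of a $\Pi^0_2$ set \<open>A\<close> is a sequence of names of open sets (given by
  enumerations) whose intersection is \<open>A\<close>.\<close>

definition rep_Pi02 :: "baire \<rightharpoonup> nat set" where
  "rep_Pi02 p = Some (\<Inter>m. enumerated (\<lambda>k. p (prod_encode (m, k))))"

definition baire_problem :: "(baire \<Rightarrow> nat set) \<Rightarrow> (baire, nat) problem" where
  "baire_problem f = \<lparr>in_rep = Some, out_rep = rep_nat, sol = f\<rparr>"

definition C_N :: "(nat set, nat) problem" where
  "C_N = \<lparr>in_rep = rep_closed, out_rep = rep_nat, sol = (\<lambda>A. A)\<rparr>"

definition Pi02ACC_N :: "(nat set, nat) problem" where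
  "Pi02ACC_N = \<lparr>in_rep = rep_Pi02, out_rep = rep_nat,
     sol = (\<lambda>A. if finite (- A) \<and> card (- A) \<le> 1 then A else {})\<rparr>"


section \<open>The limit formulation of \<open>Pi02ACC_N\<close>\<close>

definition not_limit :: "(baire, nat) problem" where
  "not_limit = baire_problem (\<lambda>p. {k. \<not> p \<longlonglongrightarrow> k})"

lemma continuous_on_finite_dependence:
  fixes F :: "baire \<Rightarrow> 'a::topological_space"
  assumes "\<And>q q'. (\<And>i. i < N \<Longrightarrow> q i = q' i) \<Longrightarrow> F q = F q'"
  shows "continuous_on UNIV F"
proof -
  have "open (F -` V)" for V
  proof (subst open_subopen, intro ballI)
    fix x assume x: "x \<in> F -` V"
    let ?T = "\<Inter>i\<in>{..<N}. (\<lambda>q::baire. q i) -` {x i}"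
    have "open ?T"
      by (intro open_INT ballI open_vimage continuous_on_product_coordinates)
        (auto simp: open_discrete)
    moreover have "?T \<subseteq> F -` V"
    proof
      fix q assume "q \<in> ?T"
      then have "F q = F x" by (intro assms) auto
      with x show "q \<in> F -` V" by simp
    qed
    ultimately show "\<exists>T. open T \<and> x \<in> T \<and> T \<subseteq> F -` V"
      by (intro exI[of _ ?T]) auto
  qed
  then show ?thesis
    by (simp add: continuous_on_open_vimage)
qed

lemma weihrauch_leI:
  fixes P :: "('x, 'y) problem" and Q :: "('u, 'y) problem"
  assumes "continuous_on UNIV H" "out_rep P = out_rep Q"
    and "\<And>p x. in_rep P p = Some x \<Longrightarrow> x \<in> mdom (sol P) \<Longrightarrow>
      \<exists>u. in_rep Q (H p) = Some u \<and> u \<in> mdom (sol Q) \<and> sol Q u \<subseteq> sol P x"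
  shows "P \<le>\<^sub>W\<^sup>* Q"
proof -
  have 1: "partial_continuous (\<lambda>p. Some (H p))"
    using assms(1) by (simp add: partial_continuous_def dom_def)
  have 2: "partial_continuous (\<lambda>z :: baire \<times> baire. Some (snd z))"
    by (simp add: partial_continuous_def dom_def continuous_on_snd[OF continuous_on_id])
  have 3: "realizes (reduction_composite (\<lambda>p. Some (H p)) (\<lambda>z. Some (snd z)) G) P"
    if G: "realizes G Q" for G
    unfolding realizes_def
  proof (intro allI impI)
    fix p x assume "in_rep P p = Some x" "x \<in> mdom (sol P)"
    from assms(3)[OF this] obtain u where
      u: "in_rep Q (H p) = Some u" "u \<in> mdom (sol Q)" "sol Q u \<subseteq> sol P x" by blast
    with G obtain q y where "G (H p) = Some q" "out_rep Q q = Some y" "y \<in> sol Q u"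
      unfolding realizes_def by blast
    with u show "\<exists>q y. reduction_composite (\<lambda>p. Some (H p)) (\<lambda>z. Some (snd z)) G p = Some q \<and>
        out_rep P q = Some y \<and> y \<in> sol P x"
      using assms(2) by (auto simp: reduction_composite_def)
  qed
  from 1 2 3 show ?thesis
    unfolding weihrauch_le_def by blast
qed

lemma tendsto_nat_iff: "p \<longlonglongrightarrow> k \<longleftrightarrow> (\<exists>m. \<forall>j\<ge>m. p j = k)" for p :: baire
  by (simp add: tendsto_discrete eventually_sequentially)

lemma not_limit_le_Pi02ACC_N: "not_limit \<le>\<^sub>W\<^sup>* Pi02ACC_N"
proof (rule weihrauch_leI)
  define H :: "baire \<Rightarrow> baire" where
    "H p i = (case prod_decode i of (m, k) \<Rightarrow> case prod_decode k of (j, n) \<Rightarrow>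
       if m \<le> j \<and> p j \<noteq> n then Suc n else 0)" for p i
  show "continuous_on UNIV H"
  proof (rule continuous_on_coordinatewise_then_product)
    fix i
    show "continuous_on UNIV (\<lambda>p. H p i)"
      by (rule continuous_on_finite_dependence[of "Suc (fst (prod_decode (snd (prod_decode i))))"])
        (auto simp: H_def split: prod.splits)
  qed
  show "out_rep not_limit = out_rep Pi02ACC_N"
    by (simp add: not_limit_def baire_problem_def Pi02ACC_N_def)
  fix p x assume "in_rep not_limit p = Some x"
  then have [simp]: "x = p" by (simp add: not_limit_def baire_problem_def)
  have "enumerated (\<lambda>k. H p (prod_encode (m, k))) = {n. \<exists>j\<ge>m. p j \<noteq> n}" for m
  proof (intro equalityI subsetI)
    fix n assume "n \<in> enumerated (\<lambda>k. H p (prod_encode (m, k)))"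
    then obtain k where "H p (prod_encode (m, k)) = Suc n"
      by (auto simp: enumerated_def)
    then show "n \<in> {n. \<exists>j\<ge>m. p j \<noteq> n}"
      by (cases "prod_decode k") (simp add: H_def split: if_splits, blast)
  next
    fix n assume "n \<in> {n. \<exists>j\<ge>m. p j \<noteq> n}"
    then obtain j where "m \<le> j" "p j \<noteq> n" by blast
    then have "H p (prod_encode (m, prod_encode (j, n))) = Suc n" by (simp add: H_def)
    then show "n \<in> enumerated (\<lambda>k. H p (prod_encode (m, k)))"
      unfolding enumerated_def by blast
  qed
  then have A: "rep_Pi02 (H p) = Some {k. \<not> p \<longlonglongrightarrow> k}"
    by (auto simp: rep_Pi02_def tendsto_nat_iff)
  have "- {k. \<not> p \<longlonglongrightarrow> k} \<subseteq> {lim p}"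
    by (auto simp: limI)
  then have fin: "finite (- {k. \<not> p \<longlonglongrightarrow> k})" "card (- {k. \<not> p \<longlonglongrightarrow> k}) \<le> 1"
    using finite_subset card_mono[of "{lim p}"] by fastforce+
  have "{k. \<not> p \<longlonglongrightarrow> k} \<noteq> {}"
    using LIMSEQ_unique[of p 0 1] by auto
  then show "\<exists>u. in_rep Pi02ACC_N (H p) = Some u \<and> u \<in> mdom (sol Pi02ACC_N) \<and>
      sol Pi02ACC_N u \<subseteq> sol not_limit x"
    using A fin by (auto simp: Pi02ACC_N_def not_limit_def baire_problem_def mdom_def)
qed

lemma Pi02ACC_N_le_not_limit: "Pi02ACC_N \<le>\<^sub>W\<^sup>* not_limit"
proof (rule weihrauch_leI)
  define refuted :: "baire \<Rightarrow> nat \<Rightarrow> nat \<Rightarrow> bool" where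
    "refuted q s i \<longleftrightarrow> (\<exists>j<s. fst (prod_decode j) = snd (prod_decode i) \<and>
       q j = Suc (fst (prod_decode i)))" for q s i
  have mono: "refuted q t i" if "refuted q s i" "s \<le> t" for q s t i
    using that less_le_trans unfolding refuted_def by blast
  define I where "I q s = (LEAST i. \<not> refuted q s i)" for q s
  define H :: "baire \<Rightarrow> baire" where "H q s = fst (prod_decode (I q s))" for q s
  show "continuous_on UNIV H"
  proof (rule continuous_on_coordinatewise_then_product)
    fix s
    show "continuous_on UNIV (\<lambda>q. H q s)"
    proof (rule continuous_on_finite_dependence[of s])
      fix q q' :: baire assume "\<And>i. i < s \<Longrightarrow> q i = q' i"
      then have "refuted q s = refuted q' s"
        by (auto simp: refuted_def fun_eq_iff)
      then show "H q s = H q' s" by (simp add: H_def I_def)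
    qed
  qed
  show "out_rep Pi02ACC_N = out_rep not_limit"
    by (simp add: not_limit_def baire_problem_def Pi02ACC_N_def)
  fix q A assume name: "in_rep Pi02ACC_N q = Some A" and "A \<in> mdom (sol Pi02ACC_N)"
  then have A: "A = (\<Inter>m. enumerated (\<lambda>k. q (prod_encode (m, k))))"
    and fin: "finite (- A)" "card (- A) \<le> 1"
    by (auto simp: Pi02ACC_N_def rep_Pi02_def mdom_def split: if_splits)
  have lim: "H q \<longlonglongrightarrow> k" if "k \<notin> A" for k
  proof -
    have compl: "n = k" if "n \<notin> A" for n
      using that \<open>k \<notin> A\<close> fin card_le_Suc0_iff_eq[of "- A"] by auto
    obtain m where m: "k \<notin> enumerated (\<lambda>l. q (prod_encode (m, l)))"
      using \<open>k \<notin> A\<close> A by blast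
    have true_pair: "\<not> refuted q s (prod_encode (k, m))" for s
    proof
      assume "refuted q s (prod_encode (k, m))"
      then obtain j where "fst (prod_decode j) = m" "q j = Suc k"
        by (auto simp: refuted_def)
      then have "q (prod_encode (m, snd (prod_decode j))) = Suc k"
        by (metis prod.collapse prod_decode_inverse)
      with m show False by (auto simp: enumerated_def)
    qed
    define i where "i = (LEAST i. \<forall>s. \<not> refuted q s i)"
    have i: "\<not> refuted q s i" for s
      unfolding i_def using LeastI_ex[of "\<lambda>i. \<forall>s. \<not> refuted q s i"] true_pair by blast
    have "\<forall>i'. \<exists>s. i' < i \<longrightarrow> refuted q s i'"
      unfolding i_def using not_less_Least by blast
    then obtain S where S: "\<And>i'. i' < i \<Longrightarrow> refuted q (S i') i'" by metis
    obtain M where M: "\<And>i'. i' < i \<Longrightarrow> S i' \<le> M"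
      using finite_imageI[OF finite_lessThan, of S i]
      by (metis finite_nat_set_iff_bounded_le imageI lessThan_iff)
    have "I q s = i" if "s \<ge> M" for s
      unfolding I_def
    proof (rule Least_equality)
      show "\<not> refuted q s i" by (rule i)
      fix y assume "\<not> refuted q s y"
      moreover have "refuted q s i'" if "i' < i" for i'
        by (rule mono[OF S[OF that] order_trans[OF M[OF that] \<open>s \<ge> M\<close>]])
      ultimately show "i \<le> y" by (meson not_le)
    qed
    moreover have "fst (prod_decode i) = k"
    proof (rule compl)
      obtain n m' where nm: "i = prod_encode (n, m')"
        by (metis prod.collapse prod_decode_inverse)
      have "q (prod_encode (m', l)) \<noteq> Suc n" for l
        using i[of "Suc (prod_encode (m', l))"] nm by (auto simp: refuted_def)
      then show "fst (prod_decode i) \<notin> A"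
        using A nm by (auto simp: enumerated_def)
    qed
    ultimately show ?thesis
      unfolding tendsto_nat_iff H_def by blast
  qed
  have "{k. \<not> H q \<longlonglongrightarrow> k} \<noteq> {}"
    using LIMSEQ_unique[of "H q" 0 1] by auto
  then show "\<exists>u. in_rep not_limit (H q) = Some u \<and> u \<in> mdom (sol not_limit) \<and>
      sol not_limit u \<subseteq> sol Pi02ACC_N A"
    using lim fin by (auto simp: Pi02ACC_N_def not_limit_def baire_problem_def mdom_def)
qed

end

theory Submission
  imports Defs
begin

text \<open>Consider the \<open>\<sigma>\<close>-ideal generated by the closed sets \<open>E\<close> that admit a common answer to all
  instances of \<open>f\<close> in \<open>E\<close>. If the domain of \<open>f\<close> lies in the ideal, then \<open>C_N\<close> can select
  from a witnessing sequence a closed set containing the input. Otherwise, since the domain is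
  analytic, it is the projection of a closed set \<open>C\<close>, and as in Solecki's theorem removing all open
  parts of \<open>C\<close> with projection in the ideal leaves a nonempty closed set \<open>Q\<close>. For every \<open>k\<close>, the
  closure of the projection of any nonempty relatively open part of \<open>Q\<close> contains an instance for
  which \<open>k\<close> is not an answer. Given \<open>p\<close>, approach such an instance for the current value of \<open>p\<close>,
  and shrink the part of \<open>Q\<close> whenever the value changes: if \<open>p\<close> converges to \<open>k\<close>, the result
  is an instance without answer \<open>k\<close>, and otherwise it is a point of the projection of \<open>Q\<close>. The
  two cases exclude each other by a Baire category argument.\<close>

section \<open>Cylinders\<close>

definition cyl :: "baire \<Rightarrow> nat \<Rightarrow> baire set" where
  "cyl x m = {y. \<forall>i<m. y i = x i}"

lemma cyl_self [simp]: "x \<in> cyl x m"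
  by (simp add: cyl_def)

lemma cyl_mono: "m \<le> n \<Longrightarrow> cyl x n \<subseteq> cyl x m"
  by (auto simp: cyl_def)

lemma cyl_eq: "y \<in> cyl x m \<Longrightarrow> cyl y m = cyl x m"
  by (auto simp: cyl_def)

lemma open_cyl: "open (cyl x m)"
proof -
  have "cyl x m = (\<Inter>i\<in>{..<m}. (\<lambda>y. y i) -` {x i})"
    by (auto simp: cyl_def)
  then show ?thesis
    by (auto intro!: open_INT open_vimage continuous_on_product_coordinates simp: open_discrete)
qed

lemma open_contains_cyl:
  assumes "open U" "x \<in> U"
  obtains m where "cyl x m \<subseteq> U"
proof -
  have "openin (product_topology (\<lambda>i::nat. euclidean :: nat topology) UNIV) U"
    using assms by (simp add: euclidean_product_topology)
  from product_topology_open_contains_basis[OF this assms(2)] obtain X where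
    X: "x \<in> (\<Pi>\<^sub>E i\<in>UNIV. X i)" "finite {i. X i \<noteq> UNIV}" "(\<Pi>\<^sub>E i\<in>UNIV. X i) \<subseteq> U"
    by auto
  obtain m where m: "\<And>i. X i \<noteq> UNIV \<Longrightarrow> i < m"
    using X(2) by (auto simp: finite_nat_set_iff_bounded)
  have "cyl x m \<subseteq> (\<Pi>\<^sub>E i\<in>UNIV. X i)"
    using X(1) m by (fastforce simp: cyl_def PiE_def Pi_def)
  with X(3) have "cyl x m \<subseteq> U" by (rule subset_trans[rotated])
  with that show thesis .
qed

lemma open_contains_cyl_Times:
  assumes "open U" "(x, y) \<in> U"
  obtains m where "cyl x m \<times> cyl y m \<subseteq> U"
proof -
  from assms obtain A B where AB: "open A" "open B" "(x, y) \<in> A \<times> B" "A \<times> B \<subseteq> U"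
    by (rule open_prod_elim)
  then have "x \<in> A" "y \<in> B" by auto
  obtain m where "cyl x m \<subseteq> A" using \<open>open A\<close> \<open>x \<in> A\<close> by (rule open_contains_cyl)
  moreover obtain n where "cyl y n \<subseteq> B" using \<open>open B\<close> \<open>y \<in> B\<close> by (rule open_contains_cyl)
  ultimately have "cyl x (max m n) \<times> cyl y (max m n) \<subseteq> U"
    using AB(4) cyl_mono[of m "max m n" x] cyl_mono[of n "max m n" y] by fastforce
  with that show thesis .
qed

lemma closed_Times_memI:
  assumes "closed Q" and "\<And>m. (cyl x m \<times> cyl y m) \<inter> Q \<noteq> {}"
  shows "(x, y) \<in> Q"
proof (rule ccontr)
  assume "(x, y) \<notin> Q"
  with assms(1) have "open (- Q)" "(x, y) \<in> - Q" by (auto simp: open_Compl)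
  then obtain m where "cyl x m \<times> cyl y m \<subseteq> - Q"
    by (rule open_contains_cyl_Times)
  with assms(2)[of m] show False by blast
qed

lemma closure_meets_cyl: "x \<in> closure S \<Longrightarrow> \<exists>s\<in>S. s \<in> cyl x m"
  using open_Int_closure_eq_empty[OF open_cyl, of x m S] cyl_self by blast


section \<open>Analytic sets\<close>

text \<open>These are the usual boldface analytic sets. The projection form supplies the closed set
  on which the kernel argument runs.\<close>

definition analytic_set :: "baire set \<Rightarrow> bool" where
  "analytic_set A \<longleftrightarrow> (\<exists>C :: (baire \<times> baire) set. closed C \<and> A = fst ` C)"

lemma analytic_set_closed:
  assumes "closed A" shows "analytic_set A"
proof -
  have "closed (A \<times> (UNIV :: baire set))" "A = fst ` (A \<times> (UNIV :: baire set))"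
    using assms by (auto intro: closed_Times)
  then show ?thesis unfolding analytic_set_def by blast
qed

lemma analytic_set_UN:
  assumes "\<And>n::nat. analytic_set (A n)"
  shows "analytic_set (\<Union>n. A n)"
proof -
  obtain C where C: "\<And>n. closed (C n)" "\<And>n. A n = fst ` (C n :: (baire \<times> baire) set)"
    using assms unfolding analytic_set_def by metis
  define T where "T = (\<lambda>z :: baire \<times> baire. (fst z, \<lambda>j. snd z (Suc j)))"
  \<comment> \<open>The first entry of a witness names \<open>n\<close> and its tail is a witness
    for \<open>A n\<close>. Phrased as an implication for every \<open>n\<close>, this makes
    \<open>E\<close> an intersection of closed sets.\<close>
  define E where "E = (\<Inter>n. {z. snd z 0 \<noteq> n} \<union> T -` C n)"
  have coord: "continuous_on UNIV (\<lambda>z :: baire \<times> baire. snd z j)" for j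
    by (rule continuous_on_product_then_coordinatewise)
      (rule continuous_on_snd[OF continuous_on_id])
  have "continuous_on UNIV T"
    unfolding T_def
    by (intro continuous_on_Pair continuous_on_fst continuous_on_id
        continuous_on_coordinatewise_then_product coord)
  moreover have "closed {z :: baire \<times> baire. snd z 0 \<noteq> n}" for n
  proof -
    have "closed ((\<lambda>z :: baire \<times> baire. snd z 0) -` (- {n}))"
      by (intro closed_vimage coord) (simp add: closed_def open_discrete)
    then show ?thesis by (simp add: vimage_def)
  qed
  ultimately have "closed E"
    unfolding E_def by (intro closed_INT ballI closed_Un closed_vimage C) auto
  moreover have "(\<Union>n. A n) = fst ` E"
  proof (intro equalityI subsetI)
    fix x assume "x \<in> (\<Union>n. A n)"
    then obtain n y where "(x, y) \<in> C n" using C(2) by force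
    then have "(x, case_nat n y) \<in> E" by (auto simp: E_def T_def)
    then show "x \<in> fst ` E" by force
  next
    fix x assume "x \<in> fst ` E"
    then obtain y where "(x, y) \<in> E" by force
    then have "(x, \<lambda>j. y (Suc j)) \<in> C (y 0)" by (auto simp: E_def T_def)
    then show "x \<in> (\<Union>n. A n)" using C(2) by force
  qed
  ultimately show ?thesis unfolding analytic_set_def by blast
qed

lemma analytic_set_INT:
  assumes "\<And>n::nat. analytic_set (A n)"
  shows "analytic_set (\<Inter>n. A n)"
proof -
  obtain C where C: "\<And>n. closed (C n)" "\<And>n. A n = fst ` (C n :: (baire \<times> baire) set)"
    using assms unfolding analytic_set_def by metis
  \<comment> \<open>One sequence carries witnesses for all \<open>n\<close> at once, the
    \<open>n\<close>-th one spread over the positions \<open>prod_encode (n, j)\<close>.\<close>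
  define T where "T = (\<lambda>n (z :: baire \<times> baire). (fst z, \<lambda>j. snd z (prod_encode (n, j))))"
  define E where "E = (\<Inter>n. T n -` C n)"
  have coord: "continuous_on UNIV (\<lambda>z :: baire \<times> baire. snd z j)" for j
    by (rule continuous_on_product_then_coordinatewise)
      (rule continuous_on_snd[OF continuous_on_id])
  have "continuous_on UNIV (T n)" for n
    unfolding T_def
    by (intro continuous_on_Pair continuous_on_fst continuous_on_id
        continuous_on_coordinatewise_then_product coord)
  then have "closed E"
    unfolding E_def by (intro closed_INT ballI closed_vimage C)
  moreover have "(\<Inter>n. A n) = fst ` E"
  proof (intro equalityI subsetI)
    fix x assume "x \<in> (\<Inter>n. A n)"
    then have "\<forall>n. \<exists>y. (x, y) \<in> C n" using C(2) by force
    then obtain y where "\<And>n. (x, y n) \<in> C n" by metis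
    then have "(x, \<lambda>i. case prod_decode i of (n, j) \<Rightarrow> y n j) \<in> E"
      by (simp add: E_def T_def)
    then show "x \<in> fst ` E" by force
  next
    fix x assume "x \<in> fst ` E"
    then show "x \<in> (\<Inter>n. A n)" using C(2) by (force simp: E_def T_def)
  qed
  ultimately show ?thesis unfolding analytic_set_def by blast
qed

text \<open>Whether \<open>cyl x m \<subseteq> U\<close> holds depends on the first \<open>m\<close>
  entries of \<open>x\<close> only, so these \<open>x\<close> form a closed set, and
  \<open>U\<close> is the countable union of these sets over \<open>m\<close>.\<close>

lemma analytic_set_open:
  assumes "open U" shows "analytic_set U"
proof -
  have "closed {x. cyl x m \<subseteq> U}" for m
  proof -
    have "- {x. cyl x m \<subseteq> U} = (\<Union>x\<in>{x. \<not> cyl x m \<subseteq> U}. cyl x m)"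
      using cyl_eq by fastforce
    then show ?thesis
      by (metis (no_types, lifting) closed_def open_UN open_cyl)
  qed
  then have "analytic_set (\<Union>m. {x. cyl x m \<subseteq> U})"
    by (intro analytic_set_UN analytic_set_closed)
  moreover have "(\<Union>m. {x. cyl x m \<subseteq> U}) = U"
    using cyl_self by (auto intro: open_contains_cyl[OF assms])
  ultimately show ?thesis by simp
qed

lemma analytic_set_borel:
  assumes "A \<in> sets borel" shows "analytic_set A"
proof -
  have "A \<in> sigma_sets UNIV {S. open S}" using assms by (simp add: sets_borel)
  \<comment> \<open>Analytic sets are not closed under complement, so the induction carries a set
    together with its complement.\<close>
  then have "analytic_set A \<and> analytic_set (- A)"
  proof induction
    case (Basic a)
    then show ?case by (auto intro: analytic_set_open analytic_set_closed)
  next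
    case Empty
    then show ?case by (auto intro: analytic_set_closed)
  next
    case (Compl a)
    then show ?case by (simp add: Compl_eq_Diff_UNIV[symmetric])
  next
    case (Union a)
    then show ?case by (auto intro: analytic_set_UN analytic_set_INT)
  qed
  then show ?thesis ..
qed


section \<open>Reducibility\<close>

lemma continuous_on_partial:
  assumes "partial_continuous F" "continuous_on S g" "g ` S \<subseteq> dom F"
  shows "continuous_on S (\<lambda>z. the (F (g z)))"
  using continuous_on_compose2[of "dom F" "\<lambda>x. the (F x)" S g] assms
  by (simp add: partial_continuous_def)

lemma weihrauch_le_trans:
  assumes "P \<le>\<^sub>W\<^sup>* Q" "Q \<le>\<^sub>W\<^sup>* R"
  shows "P \<le>\<^sub>W\<^sup>* R"
proof -
  obtain H K where HK: "partial_continuous H" "partial_continuous K"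
    "\<And>G. realizes G Q \<Longrightarrow> realizes (reduction_composite H K G) P"
    using assms(1) unfolding weihrauch_le_def by blast
  obtain H' K' where HK': "partial_continuous H'" "partial_continuous K'"
    "\<And>G. realizes G R \<Longrightarrow> realizes (reduction_composite H' K' G) Q"
    using assms(2) unfolding weihrauch_le_def by blast
  define H2 where "H2 = (\<lambda>p. Option.bind (H p) H')"
  \<comment> \<open>\<open>K'\<close> turns an answer for \<open>R\<close> into one for the
    \<open>Q\<close>-name \<open>H p\<close>, so \<open>h\<close> has to be recomputed from
    \<open>p\<close>.\<close>
  define K2 where "K2 = (\<lambda>(p, q). Option.bind (H p) (\<lambda>h. Option.bind (K' (h, q)) (\<lambda>r. K (p, r))))"
  have dom_H2: "dom H2 \<subseteq> dom H" "(\<lambda>p. the (H p)) ` dom H2 \<subseteq> dom H'"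
    by (auto simp: H2_def bind_eq_Some_conv)
  have "continuous_on (dom H2) (\<lambda>p. the (H p))"
    using HK(1) dom_H2(1) continuous_on_subset unfolding partial_continuous_def by blast
  then have "continuous_on (dom H2) (\<lambda>p. the (H' (the (H p))))"
    by (rule continuous_on_partial[OF HK'(1) _ dom_H2(2)])
  then have "partial_continuous H2"
    unfolding partial_continuous_def
    by (rule continuous_on_eq) (auto simp: H2_def bind_eq_Some_conv)
  define r where "r = (\<lambda>z. the (K' (the (H (fst z)), snd z)))"
  have dom_K2: "fst ` dom K2 \<subseteq> dom H" "(\<lambda>z. (the (H (fst z)), snd z)) ` dom K2 \<subseteq> dom K'"
    "(\<lambda>z. (fst z, r z)) ` dom K2 \<subseteq> dom K"
    by (auto simp: K2_def r_def bind_eq_Some_conv)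
  have "continuous_on (dom K2) r"
    unfolding r_def
    by (intro continuous_on_partial[OF HK'(2)] continuous_on_Pair continuous_on_partial[OF HK(1)]
        continuous_on_fst continuous_on_snd continuous_on_id dom_K2)
  then have "continuous_on (dom K2) (\<lambda>z. the (K (fst z, r z)))"
    by (intro continuous_on_partial[OF HK(2)] continuous_on_Pair
        continuous_on_fst continuous_on_id dom_K2)
  then have "partial_continuous K2"
    unfolding partial_continuous_def
    by (rule continuous_on_eq) (auto simp: K2_def r_def bind_eq_Some_conv)
  moreover have "reduction_composite H2 K2 G = reduction_composite H K (reduction_composite H' K' G)" for G
  proof
    fix p
    show "reduction_composite H2 K2 G p = reduction_composite H K (reduction_composite H' K' G) p"
    proof (cases "H p")
      case (Some h)
      then show ?thesis
        by (cases "H' h") (auto simp: reduction_composite_def H2_def K2_def split: Option.bind_split)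
    qed (simp add: reduction_composite_def H2_def)
  qed
  ultimately show ?thesis
    using \<open>partial_continuous H2\<close> HK(3) HK'(3) unfolding weihrauch_le_def by metis
qed

section \<open>Separation of the limit problem from \<open>C_N\<close>\<close>

lemma closed_not_enumerated: "closed {h. n \<notin> enumerated h}"
proof -
  have "{h. n \<notin> enumerated h} = (\<Inter>k. (\<lambda>h. h k) -` (- {Suc n}))"
    by (auto simp: enumerated_def)
  moreover have "closed (- {Suc n})" by (simp add: closed_def open_discrete)
  ultimately show ?thesis
    by (simp add: closed_INT closed_vimage)
qed

text \<open>By Baire category some fixed answer \<open>n\<close> of \<open>C_N\<close> is correct on a whole cylinder. There the
  output is a continuous function of \<open>p\<close> alone, hence locally constant, and fails on a
  sequence converging to that constant.\<close>

lemma not_limit_not_le_C_N: "\<not> not_limit \<le>\<^sub>W\<^sup>* C_N"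
proof
  assume "not_limit \<le>\<^sub>W\<^sup>* C_N"
  then obtain H K where HK: "partial_continuous H" "partial_continuous K"
    and red: "\<And>G. realizes G C_N \<Longrightarrow> realizes (reduction_composite H K G) not_limit"
    unfolding weihrauch_le_def by blast
  have inst: "\<exists>q. reduction_composite H K G p = Some q \<and> \<not> p \<longlonglongrightarrow> q 0" if "realizes G C_N" for G p
  proof -
    have "p \<in> mdom (\<lambda>p. {k. \<not> p \<longlonglongrightarrow> k})"
      using LIMSEQ_unique[of p 0 1] by (auto simp: mdom_def)
    then show ?thesis
      using red[OF that]
      by (auto simp: realizes_def not_limit_def baire_problem_def rep_nat_def)
  qed
  \<comment> \<open>Left undefined on names of the empty set: definedness of the composite at
    \<open>p\<close> then forces \<open>H p\<close> to be defined and to name a nonempty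
    set.\<close>
  define G0 :: "baire \<rightharpoonup> baire" where
    "G0 = (\<lambda>h. if - enumerated h = {} then None else Some (\<lambda>_. SOME n. n \<notin> enumerated h))"
  have G0: "realizes G0 C_N"
    by (auto simp: realizes_def C_N_def rep_closed_def rep_nat_def mdom_def G0_def
        dest: someI[of "\<lambda>n. n \<notin> enumerated _"])
  define F where "F n = {p. n \<notin> enumerated (the (H p))}" for n
  have H_total: "\<exists>h. H p = Some h" for p
    using inst[OF G0, of p] by (auto simp: reduction_composite_def bind_eq_Some_conv)
  have nonempty: "\<exists>n. p \<in> F n" for p
    using inst[OF G0, of p]
    by (auto simp: F_def reduction_composite_def bind_eq_Some_conv G0_def split: if_splits)
  \<comment> \<open>Redefining \<open>G0\<close> at the single name \<open>H p\<close> to answer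
    \<open>n\<close> leaves a realizer, so \<open>K\<close> must cope with every correct
    \<open>n\<close>, not just with the choice of \<open>G0\<close>.\<close>
  have ans: "\<exists>q. K (p, \<lambda>_. n) = Some q \<and> \<not> p \<longlonglongrightarrow> q 0" if "p \<in> F n" for p n
  proof -
    obtain h where h: "H p = Some h" using H_total by blast
    have "realizes (G0(h \<mapsto> (\<lambda>_. n))) C_N"
      using G0 that h by (auto simp: realizes_def C_N_def rep_closed_def rep_nat_def F_def)
    from inst[OF this, of p] h show ?thesis
      by (auto simp: reduction_composite_def)
  qed
  have "dom H = UNIV" using H_total by auto
  then have cont_H: "continuous_on UNIV (\<lambda>p. the (H p))"
    using HK(1) by (simp add: partial_continuous_def)
  have "closed (F n)" for n
    using closed_vimage[OF closed_not_enumerated cont_H] by (simp add: F_def vimage_def)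
  moreover have "\<Union>(range F) = UNIV" using nonempty by auto
  moreover have "completely_metrizable_space (euclidean :: baire topology)"
  proof -
    have "openin euclidean = openin (discrete_topology (UNIV :: nat set))"
      by (auto simp: fun_eq_iff open_discrete)
    then have "(euclidean :: nat topology) = discrete_topology UNIV"
      by (simp add: topology_eq)
    then show ?thesis
      unfolding euclidean_product_topology[symmetric] completely_metrizable_space_product_topology
      using completely_metrizable_space_discrete_topology[of "UNIV :: nat set"] by auto
  qed
  ultimately have "\<not> (\<forall>n. interior (F n) = {})"
    using Baire_category_alt[of "euclidean :: baire topology" "range F"] by auto
  then obtain n where "interior (F n) \<noteq> {}" by blast
  then obtain p where p: "p \<in> interior (F n)" by blast
  define g where "g = (\<lambda>p. the (K (p, \<lambda>_. n)) 0)"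
  have "(\<lambda>p. (p, \<lambda>_. n)) ` interior (F n) \<subseteq> dom K"
    using ans interior_subset[of "F n"] by blast
  then have "continuous_on (interior (F n)) (\<lambda>p. the (K (p, \<lambda>_. n)))"
    by (intro continuous_on_partial[OF HK(2)] continuous_on_Pair continuous_on_id
        continuous_on_const)
  then have "continuous_on (interior (F n)) g"
    unfolding g_def by (rule continuous_on_product_then_coordinatewise)
  then have "open (g -` {g p} \<inter> interior (F n))"
    using continuous_open_preimage[of "interior (F n)" g "{g p}"]
    by (simp add: open_discrete Int_commute)
  moreover have "p \<in> g -` {g p} \<inter> interior (F n)" using p by simp
  ultimately obtain m where m: "cyl p m \<subseteq> g -` {g p} \<inter> interior (F n)"
    by (rule open_contains_cyl)
  define p' where "p' = (\<lambda>i. if i < m then p i else g p)"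
  have "p' \<in> cyl p m" by (simp add: p'_def cyl_def)
  then have "p' \<in> F n" "g p' = g p" using m interior_subset[of "F n"] by auto
  then have "\<not> p' \<longlonglongrightarrow> g p" using ans[of p' n] by (auto simp: g_def)
  moreover have "p' \<longlonglongrightarrow> g p"
    unfolding tendsto_nat_iff p'_def by (intro exI[of _ m]) auto
  ultimately show False ..
qed


section \<open>Covers by closed sets with a common answer\<close>

text \<open>Membership in the \<sigma>-ideal. The sets \<open>E j\<close> are closed in the whole
  space and may leave \<open>mdom f\<close>; \<open>g j\<close> records the common answer on
  \<open>E j\<close>.\<close>

definition covered :: "(baire \<Rightarrow> nat set) \<Rightarrow> baire set \<Rightarrow> bool" where
  "covered f A \<longleftrightarrow> (\<exists>E g. (\<forall>j::nat. closed (E j)) \<and>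
     (\<forall>j. \<forall>x\<in>E j \<inter> mdom f. g j \<in> f x) \<and> A \<subseteq> (\<Union>j. E j))"

lemma coveredI:
  assumes "\<And>j::nat. closed (E j)" "\<And>j x. x \<in> E j \<inter> mdom f \<Longrightarrow> g j \<in> f x" "A \<subseteq> (\<Union>j. E j)"
  shows "covered f A"
  unfolding covered_def by (intro exI[of _ E] exI[of _ g]) (use assms in blast)

lemma coveredE:
  assumes "covered f A"
  obtains E g where "\<forall>j::nat. closed (E j)" "\<forall>j. \<forall>x\<in>E j \<inter> mdom f. g j \<in> f x"
    "A \<subseteq> (\<Union>j. E j)"
  using assms unfolding covered_def by (elim exE conjE)

lemma covered_subset:
  assumes "covered f B" "A \<subseteq> B" shows "covered f A"
proof -
  obtain E g where E: "\<forall>j::nat. closed (E j)" "\<forall>j. \<forall>x\<in>E j \<inter> mdom f. g j \<in> f x"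
    "B \<subseteq> (\<Union>j. E j)"
    using assms(1) by (rule coveredE)
  show ?thesis
    by (rule coveredI[of E f g]) (use assms(2) E in blast)+
qed

lemma covered_closed:
  assumes "closed E" "\<And>x. x \<in> E \<inter> mdom f \<Longrightarrow> n \<in> f x"
  shows "covered f E"
  by (rule coveredI[of "\<lambda>_. E" f "\<lambda>_. n"]) (use assms in auto)

lemma covered_UN:
  assumes "\<And>n::nat. covered f (A n)"
  shows "covered f (\<Union>n. A n)"
proof -
  obtain E g where E: "\<And>n. (\<forall>j::nat. closed (E n j)) \<and>
      (\<forall>j. \<forall>x\<in>E n j \<inter> mdom f. g n j \<in> f x) \<and> A n \<subseteq> (\<Union>j. E n j)"
    using assms unfolding covered_def by metis
  let ?E = "\<lambda>i. case prod_decode i of (n, j) \<Rightarrow> E n j"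
  have "(\<Union>n. A n) \<subseteq> (\<Union>i. ?E i)"
  proof
    fix x assume "x \<in> (\<Union>n. A n)"
    then obtain n j where "x \<in> E n j" using E by blast
    then have "x \<in> ?E (prod_encode (n, j))" by simp
    then show "x \<in> (\<Union>i. ?E i)" by (rule UN_I[OF UNIV_I])
  qed
  then show ?thesis
    by (rule coveredI[of ?E f "\<lambda>i. case prod_decode i of (n, j) \<Rightarrow> g n j", rotated 2])
      (use E in \<open>auto split: prod.splits\<close>)
qed

lemma covered_Union:
  assumes "countable \<F>" "\<And>A. A \<in> \<F> \<Longrightarrow> covered f A"
  shows "covered f (\<Union>\<F>)"
proof (cases "\<F> = {}")
  case True
  then show ?thesis using covered_closed[of "{}"] by simp
next
  case False
  then have "covered f (\<Union>n. from_nat_into \<F> n)"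
    using assms(2) by (intro covered_UN) (simp add: from_nat_into)
  then show ?thesis using False assms(1) by simp
qed

lemma covered_Un: "covered f A \<Longrightarrow> covered f B \<Longrightarrow> covered f (A \<union> B)"
  using covered_Union[of "{A, B}" f] by auto

section \<open>Covered domains: reduction to \<open>C_N\<close>\<close>

lemma covered_imp_le_C_N:
  assumes "covered f (mdom f)"
  shows "baire_problem f \<le>\<^sub>W\<^sup>* C_N"
proof -
  obtain E g where E: "\<forall>j::nat. closed (E j)" "\<forall>j. \<forall>x\<in>E j \<inter> mdom f. g j \<in> f x"
    "mdom f \<subseteq> (\<Union>j. E j)"
    using assms by (rule coveredE)
  \<comment> \<open>\<open>p \<notin> E j\<close> is witnessed by a cylinder around \<open>p\<close>
    missing the closed set \<open>E j\<close>, so these \<open>j\<close> can be enumerated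
    continuously in \<open>p\<close>. \<open>C_N\<close> returns some \<open>j\<close> with
    \<open>p \<in> E j\<close>, and \<open>g j\<close> is an answer.\<close>
  define H :: "baire \<Rightarrow> baire" where
    "H p i = (case prod_decode i of (j, m) \<Rightarrow> if cyl p m \<inter> E j = {} then Suc j else 0)" for p i
  define K :: "baire \<times> baire \<Rightarrow> baire" where "K z = (\<lambda>_. g (snd z 0))" for z
  have "continuous_on UNIV H"
  proof (rule continuous_on_coordinatewise_then_product)
    fix i
    show "continuous_on UNIV (\<lambda>p. H p i)"
      by (rule continuous_on_finite_dependence[of "snd (prod_decode i)"])
        (auto simp: H_def cyl_def split: prod.splits)
  qed
  then have 1: "partial_continuous (\<lambda>p. Some (H p))"
    by (simp add: partial_continuous_def dom_def)
  have "continuous_on UNIV (\<lambda>q::baire. g (q 0))"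
    by (rule continuous_on_finite_dependence[of 1]) auto
  then have "continuous_on UNIV (\<lambda>z::baire \<times> baire. g (snd z 0))"
    using continuous_on_compose2 continuous_on_snd[OF continuous_on_id] by blast
  then have 2: "partial_continuous (\<lambda>z. Some (K z))"
    by (auto simp: partial_continuous_def dom_def K_def
        intro: continuous_on_coordinatewise_then_product)
  have enum: "- enumerated (H p) = {j. p \<in> E j}" for p
  proof -
    have "j \<in> enumerated (H p) \<longleftrightarrow> (\<exists>m. cyl p m \<inter> E j = {})" for j
    proof
      assume "\<exists>m. cyl p m \<inter> E j = {}"
      then obtain m where "cyl p m \<inter> E j = {}" by blast
      then have "H p (prod_encode (j, m)) = Suc j" by (simp add: H_def)
      then show "j \<in> enumerated (H p)" unfolding enumerated_def by blast
    next
      assume "j \<in> enumerated (H p)"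
      then obtain k where "H p k = Suc j" by (auto simp: enumerated_def)
      then show "\<exists>m. cyl p m \<inter> E j = {}"
        by (cases "prod_decode k") (auto simp: H_def split: if_splits)
    qed
    moreover have "(\<exists>m. cyl p m \<inter> E j = {}) \<longleftrightarrow> p \<notin> E j" for j
    proof
      assume "p \<notin> E j"
      with E(1) have "open (- E j)" "p \<in> - E j" by (auto simp: open_Compl)
      then obtain m where "cyl p m \<subseteq> - E j" by (rule open_contains_cyl)
      then show "\<exists>m. cyl p m \<inter> E j = {}" by blast
    qed (use cyl_self in blast)
    ultimately show ?thesis by auto
  qed
  have "realizes (reduction_composite (\<lambda>p. Some (H p)) (\<lambda>z. Some (K z)) G) (baire_problem f)"
    if G: "realizes G C_N" for G
    unfolding realizes_def
  proof (intro allI impI)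
    fix p x assume "in_rep (baire_problem f) p = Some x" "x \<in> mdom (sol (baire_problem f))"
    then have x: "x = p" "p \<in> mdom f" by (auto simp: baire_problem_def)
    then have "in_rep C_N (H p) = Some {j. p \<in> E j}" "{j. p \<in> E j} \<in> mdom (sol C_N)"
      using E(3) enum by (auto simp: C_N_def rep_closed_def mdom_def)
    with G obtain q y where "G (H p) = Some q" "out_rep C_N q = Some y" "y \<in> sol C_N {j. p \<in> E j}"
      unfolding realizes_def by blast
    then have "G (H p) = Some q" "p \<in> E (q 0)" by (auto simp: C_N_def rep_nat_def)
    then show "\<exists>q y. reduction_composite (\<lambda>p. Some (H p)) (\<lambda>z. Some (K z)) G p = Some q \<and>
        out_rep (baire_problem f) q = Some y \<and> y \<in> sol (baire_problem f) x"
      using x E(2) by (auto simp: reduction_composite_def baire_problem_def rep_nat_def K_def)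
  qed
  with 1 2 show ?thesis
    unfolding weihrauch_le_def
    by (intro exI[of _ "\<lambda>p. Some (H p)"] exI[of _ "\<lambda>z. Some (K z)"]) simp
qed

section \<open>Uncovered domains: the kernel and the reduction of the limit problem\<close>

lemma uncovered_kernel:
  fixes C :: "(baire \<times> baire) set"
  assumes "closed C" "\<not> covered f (fst ` C)"
  obtains Q where "closed Q" "Q \<subseteq> C" "Q \<noteq> {}"
    "\<And>U. open U \<Longrightarrow> U \<inter> Q \<noteq> {} \<Longrightarrow> \<not> covered f (fst ` (U \<inter> Q))"
proof -
  define \<U> where "\<U> = {U. open U \<and> covered f (fst ` (U \<inter> C))}"
  define Q where "Q = C - \<Union>\<U>"
  \<comment> \<open>Countably many of the open sets already remove everything, so the removed part
    of \<open>C\<close> has a covered projection.\<close>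
  obtain \<V> where \<V>: "\<V> \<subseteq> \<U>" "countable \<V>" "\<Union>\<V> = \<Union>\<U>"
    using Lindelof[of \<U>] by (auto simp: \<U>_def)
  have "covered f (\<Union>((\<lambda>U. fst ` (U \<inter> C)) ` \<V>))"
    using \<V> by (intro covered_Union) (auto simp: \<U>_def)
  then have rest: "covered f (fst ` (\<Union>\<U> \<inter> C))"
    by (rule covered_subset) (use \<V>(3) in blast)
  show thesis
  proof
    show "closed Q"
      unfolding Q_def by (intro closed_Diff assms open_Union) (simp add: \<U>_def)
    show "Q \<subseteq> C" by (auto simp: Q_def)
    show "Q \<noteq> {}"
    proof
      assume "Q = {}"
      then have "\<Union>\<U> \<inter> C = C" by (auto simp: Q_def)
      with rest assms show False by simp
    qed
    fix U assume U: "open U" "U \<inter> Q \<noteq> {}"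
    show "\<not> covered f (fst ` (U \<inter> Q))"
    proof
      assume "covered f (fst ` (U \<inter> Q))"
      \<comment> \<open>A covered part of \<open>Q\<close> stays covered after adding the removed
        points, so \<open>U\<close> would itself have been removed.\<close>
      then have "covered f (fst ` (U \<inter> C))"
        using rest by (rule covered_subset[OF covered_Un]) (auto simp: Q_def)
      then have "U \<in> \<U>" using U by (simp add: \<U>_def)
      with U show False by (auto simp: Q_def)
    qed
  qed
qed

text \<open>A state \<open>(z, l, x)\<close> of the construction announces the output \<open>x\<close>, on which the current
  guess \<open>k\<close> is not an answer, together with a neighbourhood of \<open>z\<close> in \<open>Q\<close> whose projection
  accumulates at \<open>x\<close>. If the guess changes, one moves to a smaller neighbourhood projecting close
  to \<open>x\<close>. After infinitely many changes the neighbourhoods shrink to a point of \<open>Q\<close>.\<close>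

lemma uncovered_imp_not_limit_le:
  assumes "analytic_set (mdom f)" "\<not> covered f (mdom f)"
  shows "not_limit \<le>\<^sub>W\<^sup>* baire_problem f"
proof -
  obtain C :: "(baire \<times> baire) set" where C: "closed C" "mdom f = fst ` C"
    using assms(1) unfolding analytic_set_def by blast
  obtain Q where Q: "closed Q" "Q \<subseteq> C" "Q \<noteq> {}"
    "\<And>U. open U \<Longrightarrow> U \<inter> Q \<noteq> {} \<Longrightarrow> \<not> covered f (fst ` (U \<inter> Q))"
    using uncovered_kernel[of C f] C assms(2) by metis
  define nb where "nb z l = (cyl (fst z) l \<times> cyl (snd z) l) \<inter> Q" for z l
  define ok where "ok k s \<longleftrightarrow> fst s \<in> Q \<and> snd (snd s) \<in> closure (fst ` nb (fst s) (fst (snd s))) \<and>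
    snd (snd s) \<in> mdom f \<and> k \<notin> f (snd (snd s))" for k s
  \<comment> \<open>The first two clauses make the neighbourhoods shrink and nest, the third makes
    the outputs converge.\<close>
  define step where "step m s s' \<longleftrightarrow> fst (snd s') = m \<and> fst s' \<in> nb (fst s) (fst (snd s)) \<and>
    snd (snd s') \<in> cyl (snd (snd s)) m" for m and s s' :: "(baire \<times> baire) \<times> nat \<times> baire"
  \<comment> \<open>Otherwise \<open>k\<close> would be a common answer on the closure of the
    projection, a closed set, which would then be covered.\<close>
  have ex: "\<exists>x. ok k (z, l, x)" if "z \<in> Q" for k z l
  proof -
    have "open (cyl (fst z) l \<times> cyl (snd z) l)"
      by (intro open_Times open_cyl)
    moreover have "z \<in> (cyl (fst z) l \<times> cyl (snd z) l) \<inter> Q"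
      using that by (simp add: mem_Times_iff)
    ultimately have "\<not> covered f (fst ` nb z l)"
      unfolding nb_def by (intro Q(4)) auto
    then have "\<not> covered f (closure (fst ` nb z l))"
      using covered_subset[OF _ closure_subset] by blast
    then obtain x where "x \<in> closure (fst ` nb z l) \<inter> mdom f" "k \<notin> f x"
      using covered_closed[OF closed_closure, of "fst ` nb z l" f k] by blast
    with that show ?thesis by (auto simp: ok_def)
  qed
  have step_ex: "\<exists>s'. ok k' s' \<and> step m s s'" if "ok k s" for k k' m s
  proof -
    obtain z l x where s: "s = (z, l, x)" by (cases s)
    with that obtain z' where z': "z' \<in> nb z l" "fst z' \<in> cyl x m"
      using closure_meets_cyl[of x "fst ` nb z l" m] by (auto simp: ok_def)
    then obtain x' where x': "ok k' (z', m, x')" using ex[of z'] by (auto simp: nb_def)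
    \<comment> \<open>\<open>w\<close> links the two outputs: \<open>x'\<close> agrees with
      \<open>w\<close>, \<open>w\<close> with \<open>fst z'\<close>, and \<open>fst z'\<close> with
      \<open>x\<close>, each on the first \<open>m\<close> entries.\<close>
    then obtain w where "w \<in> cyl x' m" "w \<in> cyl (fst z') m"
      using closure_meets_cyl[of x' "fst ` nb z' m" m] by (fastforce simp: ok_def nb_def)
    then have "x' \<in> cyl x m" using z'(2) by (auto simp: cyl_def)
    with x' z' s show ?thesis
      by (intro exI[of _ "(z', m, x')"]) (simp add: step_def)
  qed
  define nxt where "nxt k' m s = (SOME s'. ok k' s' \<and> step m s s')" for k' m s
  have nxt: "ok k' (nxt k' m s) \<and> step m s (nxt k' m s)" if "ok k s" for k k' m s
    unfolding nxt_def by (rule someI_ex) (rule step_ex[OF that])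
  \<comment> \<open>Precision 0 at the start is the base case of \<open>ll p j \<le> j\<close>
    below.\<close>
  have "\<exists>s. ok k s \<and> fst (snd s) = 0" for k
  proof -
    from Q(3) obtain z where "z \<in> Q" by blast
    then obtain x where "ok k (z, 0, x)" using ex by blast
    then show ?thesis by (intro exI[of _ "(z, 0, x)"]) simp
  qed
  then obtain init where init: "\<And>k. ok k (init k)" and init_l: "\<And>k. fst (snd (init k)) = 0"
    by metis
  have nb_subset: "nb z' l' \<subseteq> nb z l" if "z' \<in> nb z l" "l \<le> l'" for z z' l l'
    using that cyl_mono[OF that(2)] cyl_eq by (fastforce simp: nb_def)
  define st where "st p = rec_nat (init (p 0))
    (\<lambda>t s. if p (Suc t) = p t then s else nxt (p (Suc t)) (Suc t) s)" for p :: baire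
  have st0: "st p 0 = init (p 0)"
    and stS: "st p (Suc t) = (if p (Suc t) = p t then st p t else nxt (p (Suc t)) (Suc t) (st p t))" for p t
    by (auto simp: st_def)
  have st_ok: "ok (p t) (st p t)" for p t
    by (induction t) (auto simp: st0 stS init nxt)
  define zz where "zz p t = fst (st p t)" for p t
  define ll where "ll p t = fst (snd (st p t))" for p t
  define xx where "xx p t = snd (snd (st p t))" for p t
  have ok: "zz p t \<in> Q" "xx p t \<in> closure (fst ` nb (zz p t) (ll p t))" "xx p t \<in> mdom f"
    "p t \<notin> f (xx p t)" for p t
    using st_ok[of p t] by (simp_all add: ok_def zz_def ll_def xx_def)
  have change: "ll p (Suc t) = Suc t \<and> zz p (Suc t) \<in> nb (zz p t) (ll p t) \<and>
      xx p (Suc t) \<in> cyl (xx p t) (Suc t)" if "p (Suc t) \<noteq> p t" for p t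
    using nxt[OF st_ok[of p t], of "p (Suc t)" "Suc t"] that
    by (simp add: zz_def ll_def xx_def stS step_def)
  have same: "ll p (Suc t) = ll p t \<and> zz p (Suc t) = zz p t \<and> xx p (Suc t) = xx p t"
    if "p (Suc t) = p t" for p t
    using that by (simp add: zz_def ll_def xx_def stS)
  \<comment> \<open>A change at time \<open>Suc t\<close> keeps the first \<open>Suc t\<close>
    entries, so entry \<open>i\<close> is final at time \<open>i\<close> and depends only on
    \<open>p 0, ..., p i\<close>.\<close>
  define H :: "baire \<Rightarrow> baire" where "H p i = xx p i i" for p i
  have x_agree: "xx p (t + d) \<in> cyl (xx p t) (Suc t)" for p t d
  proof (induction d)
    case (Suc d)
    have "xx p (Suc (t + d)) \<in> cyl (xx p (t + d)) (Suc (t + d))"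
      using change[of p "t + d"] same[of p "t + d"] by (cases "p (Suc (t + d)) = p (t + d)") auto
    with Suc show ?case by (auto simp: cyl_def)
  qed simp
  have H_agree: "H p \<in> cyl (xx p t) (Suc t)" for p t
  proof -
    have "H p i = xx p t i" if "i < Suc t" for i
      using x_agree[of p i "t - i"] that by (auto simp: H_def cyl_def)
    then show ?thesis by (simp add: cyl_def)
  qed
  have H_spec: "H p \<in> mdom f \<and> (\<forall>k\<in>f (H p). \<not> p \<longlonglongrightarrow> k)" for p
  proof (cases "\<exists>t. \<forall>j\<ge>t. p j = p t")
    case True
    then obtain t where t: "\<And>j. j \<ge> t \<Longrightarrow> p j = p t" by blast
    have const: "xx p (t + d) = xx p t" for d
    proof (induction d)
      case (Suc d)
      then show ?case using same[of p "t + d"] t[of "t + d"] t[of "Suc (t + d)"] by simp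
    qed simp
    have "H p i = xx p t i" for i
      using H_agree[of p "t + i"] const[of i] by (simp add: cyl_def)
    then have "H p = xx p t" by (rule ext)
    moreover have "p \<longlonglongrightarrow> p t" unfolding tendsto_nat_iff using t by blast
    then have "\<And>k. p \<longlonglongrightarrow> k \<Longrightarrow> k = p t" by (rule LIMSEQ_unique[rotated])
    ultimately show ?thesis using ok(3,4)[of p t] by auto
  next
    case False
    then have no_lim: "\<not> p \<longlonglongrightarrow> k" for k
      unfolding tendsto_nat_iff by blast
    have change_ex: "\<exists>t\<ge>m. ll p t \<ge> m" for m
    proof -
      have "\<exists>t\<ge>m. p (Suc t) \<noteq> p t"
      proof (rule ccontr)
        assume "\<not> ?thesis"
        then have "p (m + d) = p m" for d by (induction d) auto
        then have "\<forall>j\<ge>m. p j = p m" using le_Suc_ex by blast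
        with False show False by blast
      qed
      then obtain t where "t \<ge> m" "p (Suc t) \<noteq> p t" by blast
      then show ?thesis using change[of p t] by (intro exI[of _ "Suc t"]) simp
    qed
    \<comment> \<open>A change at time \<open>Suc j\<close> sets the precision to
      \<open>Suc j\<close>, so it never lowers it; nesting the neighbourhoods requires this.\<close>
    have l_le: "ll p j \<le> j" for j
    proof (induction j)
      case (Suc j)
      then show ?case using change[of p j] same[of p j] by (cases "p (Suc j) = p j") auto
    qed (simp add: ll_def st0 init_l)
    have nested: "ll p t \<le> ll p (t + d) \<and> zz p (t + d) \<in> nb (zz p t) (ll p t)" for t d
    proof (induction d)
      case 0
      then show ?case using ok(1) by (auto simp: nb_def mem_Times_iff)
    next
      case (Suc d)
      show ?case
      proof (cases "p (Suc (t + d)) = p (t + d)")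
        case True
        then show ?thesis using Suc same by simp
      next
        case False
        with Suc change[of p "t + d"] l_le[of "t + d"] show ?thesis
          using nb_subset[of "zz p (t + d)" "zz p t" "ll p t" "ll p (t + d)"] by auto
      qed
    qed
    obtain \<tau> where \<tau>: "\<And>m. m \<le> \<tau> m" "\<And>m. m \<le> ll p (\<tau> m)"
      using change_ex by metis
    \<comment> \<open>The centre at time \<open>t + t'\<close> lies in both neighbourhoods, so each
      centre is compared with it.\<close>
    have snd_agree: "snd (zz p t) i = snd (zz p t') i" if "i < ll p t" "i < ll p t'" for t t' i
    proof -
      have "snd (zz p (t + t')) i = snd (zz p t) i" "snd (zz p (t' + t)) i = snd (zz p t') i"
        using nested[of t t'] nested[of t' t] that by (auto simp: nb_def mem_Times_iff cyl_def)
      then show ?thesis by (simp add: add.commute)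
    qed
    \<comment> \<open>At time \<open>\<tau> (Suc i)\<close> the precision exceeds \<open>i\<close>,
      so entry \<open>i\<close> of the second coordinate has settled.\<close>
    define y where "y i = snd (zz p (\<tau> (Suc i))) i" for i
    have "(H p, y) \<in> Q"
    proof (rule closed_Times_memI[OF Q(1)])
      fix m
      define t where "t = \<tau> m"
      \<comment> \<open>The centre need not be near the output, but its neighbourhood contains a
        point projecting near it, and at precision at least \<open>m\<close> that point agrees with
        the centre on the first \<open>m\<close> entries.\<close>
      obtain w where w: "w \<in> nb (zz p t) (ll p t)" "fst w \<in> cyl (xx p t) m"
        using closure_meets_cyl[OF ok(2)] by blast
      have "fst (zz p t) \<in> cyl (H p) m"
        unfolding cyl_def
      proof (intro CollectI allI impI)
        fix i assume "i < m"
        have "i < ll p t" "i < Suc t" using \<open>i < m\<close> \<tau>[of m] by (simp_all add: t_def)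
        have "fst (zz p t) i = fst w i"
          using w(1) \<open>i < ll p t\<close> by (simp add: nb_def mem_Times_iff cyl_def)
        also have "fst w i = xx p t i" using w(2) \<open>i < m\<close> by (simp add: cyl_def)
        also have "xx p t i = H p i" using H_agree[of p t] \<open>i < Suc t\<close> by (simp add: cyl_def)
        finally show "fst (zz p t) i = H p i" .
      qed
      moreover have "snd (zz p t) \<in> cyl y m"
        unfolding cyl_def
      proof (intro CollectI allI impI)
        fix i assume "i < m"
        then show "snd (zz p t) i = y i"
          unfolding y_def t_def using \<tau>(2)[of m] \<tau>(2)[of "Suc i"] by (intro snd_agree) auto
      qed
      ultimately have "zz p t \<in> cyl (H p) m \<times> cyl y m \<inter> Q"
        using ok(1)[of p t] by (simp add: mem_Times_iff)
      then show "cyl (H p) m \<times> cyl y m \<inter> Q \<noteq> {}" by (metis empty_iff)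
    qed
    with Q(2) have "H p \<in> mdom f"
      unfolding C(2) by (intro image_eqI[of _ fst "(H p, y)"]) auto
    with no_lim show ?thesis by simp
  qed
  show ?thesis
  proof (rule weihrauch_leI)
    show "continuous_on UNIV H"
    proof (rule continuous_on_coordinatewise_then_product)
      fix i
      have st_cong: "st p t = st q t" if "\<And>i. i < Suc t \<Longrightarrow> p i = q i" for p q t
        using that by (induction t) (auto simp: st0 stS)
      show "continuous_on UNIV (\<lambda>p. H p i)"
      proof (rule continuous_on_finite_dependence)
        fix p q :: baire assume "\<And>j. j < Suc i \<Longrightarrow> p j = q j"
        then have "st p i = st q i" by (rule st_cong)
        then show "H p i = H q i" by (simp add: H_def xx_def)
      qed
    qed
  qed (use H_spec in \<open>auto simp: not_limit_def baire_problem_def mdom_def\<close>)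
qed

theorem theorem31:
  fixes f :: "baire \<Rightarrow> nat set"
  assumes "\<And>n. {x \<in> mdom f. n \<in> f x} \<in> sets borel"
  shows "(baire_problem f \<le>\<^sub>W\<^sup>* C_N \<and> \<not> Pi02ACC_N \<le>\<^sub>W\<^sup>* baire_problem f) \<or>
         (\<not> baire_problem f \<le>\<^sub>W\<^sup>* C_N \<and> Pi02ACC_N \<le>\<^sub>W\<^sup>* baire_problem f)"
proof -
  \<comment> \<open>The domain is a countable union of Borel sets, hence analytic.\<close>
  have "mdom f = (\<Union>n. {x \<in> mdom f. n \<in> f x})"
    by (auto simp: mdom_def)
  then have proj: "analytic_set (mdom f)"
    by (metis (no_types, lifting) assms analytic_set_UN analytic_set_borel)
  \<comment> \<open>Both reductions together would compose to one of \<open>not_limit\<close> to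
    \<open>C_N\<close>.\<close>
  have "\<not> (baire_problem f \<le>\<^sub>W\<^sup>* C_N \<and> Pi02ACC_N \<le>\<^sub>W\<^sup>* baire_problem f)"
    using not_limit_not_le_C_N not_limit_le_Pi02ACC_N weihrauch_le_trans by metis
  moreover have "baire_problem f \<le>\<^sub>W\<^sup>* C_N \<or> Pi02ACC_N \<le>\<^sub>W\<^sup>* baire_problem f"
  proof (cases "covered f (mdom f)")
    case True
    then show ?thesis by (simp add: covered_imp_le_C_N)
  next
    case False
    then have "not_limit \<le>\<^sub>W\<^sup>* baire_problem f"
      by (rule uncovered_imp_not_limit_le[OF proj])
    then show ?thesis
      using Pi02ACC_N_le_not_limit weihrauch_le_trans by metis
  qed
  ultimately show ?thesis by blast
qed

end
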